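(* For all positive integers $m$ and $k$, $$\begin{aligned} \zeta\left(\bar1,\{1\}_{m-1},2,\{1\}_{k-1}\right)=&\ (-1)^m\binom{m+k}{k}\,\zeta\left(\bar2,\{1\}_{m+k-1}\right)-\frac{(\ln2)^m}{m!}\,\zeta\left(\bar2,\{1\}_{k-1}\right)\\ &-\sum_{i=1}^{m-1}\frac{(\ln2)^i}{i!}\,\zeta\left(\bar1,\{1\}_{m-i-1},2,\{1\}_{k-1}\right). \end{aligned}$$
   Context: Notation. $\{1\}_r$ denotes the string of $r$ entries equal to $1$ (empty if $r=0$). For positive integers $s_1,\dots,s_r$, $\zeta(s_1,\dots,s_r):=\lim_{n\to\infty}\sum_{n\ge k_1>\cdots>k_r\ge1}\frac{1}{k_1^{s_1}\cdots k_r^{s_r}}$. A bar over an entry $s_j$ means that the factor $(-1)^{k_j}$ is inserted in the summand; e.g. $\zeta(\bar1,\{1\}_{m-1},2,\{1\}_{k-1})=\lim_{n\to\infty}\sum_{n\ge k_1>\cdots>k_{m+k}\ge1}\frac{(-1)^{k_1}}{k_1\cdots k_m\,k_{m+1}^2\,k_{m+2}\cdots k_{m+k}}$. Sums over empty ranges are $0$. *)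

theory Defs
  imports "HOL-Analysis.Analysis"
begin

text \<open>
  An entry of the argument string of an alternating multiple zeta value: \<open>Plain s\<close>
  stands for \<open>s\<close>, and \<open>Bar s\<close> for \<open>s\<close> with a bar over it.
\<close>

datatype mzv_entry = Plain nat | Bar nat

fun mzv_factor :: "mzv_entry \<Rightarrow> nat \<Rightarrow> real" where
  "mzv_factor (Plain s) k = 1 / real k ^ s"
| "mzv_factor (Bar s) k = (- 1) ^ k / real k ^ s"

text \<open>
  The summation indices \<open>n \<ge> k\<^sub>1 > \<dots> > k\<^sub>r \<ge> 1\<close>, as the list \<open>[k\<^sub>1, \<dots>, k\<^sub>r]\<close>.
\<close>

definition mzv_indices :: "nat \<Rightarrow> nat \<Rightarrow> nat list set" where
  "mzv_indices r n = {ks. length ks = r \<and> sorted_wrt (>) ks \<and> set ks \<subseteq> {1..n}}"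

definition mzv_partial_sum :: "mzv_entry list \<Rightarrow> nat \<Rightarrow> real" where
  "mzv_partial_sum ss n =
     (\<Sum>ks \<in> mzv_indices (length ss) n. \<Prod>j<length ss. mzv_factor (ss ! j) (ks ! j))"

text \<open>The value is meaningful only when the partial sums converge.\<close>

definition mzv :: "mzv_entry list \<Rightarrow> real" where
  "mzv ss = lim (mzv_partial_sum ss)"

end

theory Submission
  imports Defs "HOL-Real_Asymp.Real_Asymp"
begin

text \<open>
  Put \<open>L = - ln (1 - X)\<close>, and let \<open>F\<^sub>i\<close> be the polylogarithm series of the word
  \<open>{1}\<^sub>i, 2, {1}\<^sub>k\<^sub>-\<^sub>1\<close>. Since \<open>(1 - X) L' = 1\<close> and \<open>(1 - X) F\<^sub>i' = F\<^sub>i\<^sub>-\<^sub>1\<close>, the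
  derivative of \<open>\<Sum>i\<le>m. (- L)\<^sup>i / i! F\<^sub>m\<^sub>-\<^sub>i\<close> telescopes to \<open>(- L)\<^sup>m / m! F\<^sub>0'\<close>, where
  \<open>X F\<^sub>0' = L\<^sup>k / k!\<close>. This is a multiple of \<open>L\<^sup>m\<^sup>+\<^sup>k / (m + k)!\<close>, which is \<open>X\<close> times the
  derivative of the series of the word \<open>2, {1}\<^sub>m\<^sub>+\<^sub>k\<^sub>-\<^sub>1\<close>. The theorem is the resulting identity of
  formal power series read off at \<open>X = - 1\<close>. There the series converge only conditionally, but they
  become absolutely convergent after multiplication by a power of \<open>1 - X\<close>, which takes the nonzero
  value \<open>2\<close> at \<open>- 1\<close>; hence evaluation remains multiplicative.
\<close>

unbundle no vec_syntax and fps_syntax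

subsection \<open>Values of power series at $-1$\<close>

text \<open>Absolute summability is built in so that Cauchy products keep their value; a relation
  rather than a function makes convergence part of every claim.\<close>

definition abs_eval_m1 :: "real fps \<Rightarrow> real \<Rightarrow> bool" where
  "abs_eval_m1 f v \<longleftrightarrow> summable (\<lambda>n. \<bar>f $ n\<bar>) \<and> (\<lambda>n. (- 1) ^ n * f $ n) sums v"

text \<open>A regularised value, assigned even to some series that diverge at -1: the geometric
  series 1/(1 - X) gets 1/2. Thus a product has a value without any convergence claim for its own
  coefficient sum.\<close>

definition eval_m1 :: "real fps \<Rightarrow> real \<Rightarrow> bool" where
  "eval_m1 f v \<longleftrightarrow> (\<exists>N. abs_eval_m1 ((1 - fps_X) ^ N * f) (2 ^ N * v))"

lemma abs_eval_m1_exists: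
  assumes "summable (\<lambda>n. \<bar>f $ n\<bar>)"
  shows "\<exists>v. abs_eval_m1 f v"
proof -
  have "summable (\<lambda>n. (- 1) ^ n * f $ n)"
    by (rule summable_norm_cancel) (simp add: abs_mult assms)
  then show ?thesis
    unfolding abs_eval_m1_def using assms by (auto simp: summable_def)
qed

lemma abs_eval_m1_const: "abs_eval_m1 (fps_const c) c"
proof -
  have "summable (\<lambda>n. \<bar>fps_const c $ n\<bar>)"
    by (rule summable_finite[of "{0}"]) auto
  moreover have "(\<lambda>n. (- 1) ^ n * fps_const c $ n) sums (\<Sum>n\<in>{0}. (- 1) ^ n * fps_const c $ n)"
    by (rule sums_finite) auto
  ultimately show ?thesis
    by (simp add: abs_eval_m1_def)
qed

lemma abs_eval_m1_1_minus_X: "abs_eval_m1 (1 - fps_X) 2"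
proof -
  have "summable (\<lambda>n. \<bar>(1 - fps_X :: real fps) $ n\<bar>)"
    by (rule summable_finite[of "{0, 1}"]) auto
  moreover have "(\<lambda>n. (- 1) ^ n * (1 - fps_X :: real fps) $ n) sums
      (\<Sum>n\<in>{0, 1}. (- 1) ^ n * (1 - fps_X :: real fps) $ n)"
    by (rule sums_finite) auto
  ultimately show ?thesis
    by (simp add: abs_eval_m1_def)
qed

lemma abs_eval_m1_add:
  assumes "abs_eval_m1 f u" "abs_eval_m1 g v"
  shows "abs_eval_m1 (f + g) (u + v)"
proof -
  have "summable (\<lambda>n. \<bar>(f + g) $ n\<bar>)"
    by (rule summable_comparison_test'[of "\<lambda>n. \<bar>f $ n\<bar> + \<bar>g $ n\<bar>"])
      (use assms in \<open>auto simp: abs_eval_m1_def intro: summable_add\<close>)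
  then show ?thesis
    using assms sums_add[of "\<lambda>n. (- 1) ^ n * f $ n" u "\<lambda>n. (- 1) ^ n * g $ n" v]
    by (simp add: abs_eval_m1_def algebra_simps)
qed

lemma abs_eval_m1_mult:
  assumes "abs_eval_m1 f u" "abs_eval_m1 g v"
  shows "abs_eval_m1 (f * g) (u * v)"
proof -
  have sf: "summable (\<lambda>n. \<bar>f $ n\<bar>)" and sg: "summable (\<lambda>n. \<bar>g $ n\<bar>)"
    and u: "(\<lambda>n. (- 1) ^ n * f $ n) sums u" and v: "(\<lambda>n. (- 1) ^ n * g $ n) sums v"
    using assms by (auto simp: abs_eval_m1_def)
  have "summable (\<lambda>n. \<Sum>i\<le>n. \<bar>f $ i\<bar> * \<bar>g $ (n - i)\<bar>)"
    by (rule summable_Cauchy_product) (simp_all add: sf sg)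
  then have summ: "summable (\<lambda>n. \<bar>(f * g) $ n\<bar>)"
    by (rule summable_comparison_test')
      (auto simp: fps_mult_nth atLeast0AtMost abs_mult intro!: order.trans[OF sum_abs])
  have "(\<lambda>n. \<Sum>i\<le>n. ((- 1) ^ i * f $ i) * ((- 1) ^ (n - i) * g $ (n - i))) sums
      ((\<Sum>n. (- 1) ^ n * f $ n) * (\<Sum>n. (- 1) ^ n * g $ n))"
    by (rule Cauchy_product_sums) (simp_all add: abs_mult sf sg)
  moreover have "(\<Sum>i\<le>n. ((- 1) ^ i * f $ i) * ((- 1) ^ (n - i) * g $ (n - i))) = (- 1) ^ n * (f * g) $ n" for n
  proof -
    have "((- 1) ^ i * f $ i) * ((- 1) ^ (n - i) * g $ (n - i)) = (- 1) ^ n * (f $ i * g $ (n - i))"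
      if "i \<le> n" for i
    proof -
      have "(- 1 :: real) ^ i * (- 1) ^ (n - i) = (- 1) ^ n"
        using that by (simp flip: power_add)
      then show ?thesis
        by (metis mult.assoc mult.left_commute)
    qed
    then show ?thesis
      unfolding fps_mult_nth atLeast0AtMost sum_distrib_left
      by (intro sum.cong refl) (use atMost_iff in blast)
  qed
  ultimately show ?thesis
    using u v summ by (simp add: abs_eval_m1_def sums_iff)
qed

lemma abs_eval_m1_unique:
  assumes "abs_eval_m1 f u" "abs_eval_m1 f v"
  shows "u = v"
  using assms sums_unique2 by (auto simp: abs_eval_m1_def)

lemma abs_eval_m1_1_minus_X_power: "abs_eval_m1 ((1 - fps_X) ^ N) (2 ^ N)"
proof (induction N)
  case 0
  show ?case using abs_eval_m1_const[of 1] by simp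
next
  case (Suc N)
  show ?case using abs_eval_m1_mult[OF abs_eval_m1_1_minus_X Suc] by simp
qed

text \<open>Brings the exponents of two \<open>eval_m1\<close> witnesses to a common one: each
  further factor 1 - X contributes a factor 2.\<close>

lemma abs_eval_m1_raise:
  assumes "abs_eval_m1 ((1 - fps_X) ^ N * f) (2 ^ N * v)" "N \<le> M"
  shows "abs_eval_m1 ((1 - fps_X) ^ M * f) (2 ^ M * v)"
proof -
  obtain d where "M = d + N"
    using assms(2) by (metis le_add_diff_inverse2)
  then show ?thesis
    using abs_eval_m1_mult[OF abs_eval_m1_1_minus_X_power[of d] assms(1)]
    by (simp add: power_add mult.assoc)
qed

text \<open>At a common exponent the two values differ only by the nonzero factor 2^max. This is
  what turns an identity of series into an identity of numbers.\<close>

lemma eval_m1_unique: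
  assumes "eval_m1 f u" "eval_m1 f v"
  shows "u = v"
proof -
  obtain N M where NM: "abs_eval_m1 ((1 - fps_X) ^ N * f) (2 ^ N * u)"
    "abs_eval_m1 ((1 - fps_X) ^ M * f) (2 ^ M * v)"
    using assms unfolding eval_m1_def by blast
  have "2 ^ max N M * u = 2 ^ max N M * v"
    using abs_eval_m1_raise[OF NM(1), of "max N M"] abs_eval_m1_raise[OF NM(2), of "max N M"]
    by (intro abs_eval_m1_unique) auto
  then show ?thesis by simp
qed

lemma abs_eval_m1_imp_eval_m1: "abs_eval_m1 f v \<Longrightarrow> eval_m1 f v"
  unfolding eval_m1_def by (rule exI[of _ 0]) simp

lemma eval_m1_const: "eval_m1 (fps_const c) c"
  by (intro abs_eval_m1_imp_eval_m1 abs_eval_m1_const)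

lemma eval_m1_add:
  assumes "eval_m1 f u" "eval_m1 g v"
  shows "eval_m1 (f + g) (u + v)"
proof -
  obtain N M where NM: "abs_eval_m1 ((1 - fps_X) ^ N * f) (2 ^ N * u)"
    "abs_eval_m1 ((1 - fps_X) ^ M * g) (2 ^ M * v)"
    using assms unfolding eval_m1_def by blast
  have "abs_eval_m1 ((1 - fps_X) ^ max N M * f + (1 - fps_X) ^ max N M * g)
      (2 ^ max N M * u + 2 ^ max N M * v)"
    by (intro abs_eval_m1_add abs_eval_m1_raise[OF NM(1)] abs_eval_m1_raise[OF NM(2)]) auto
  then show ?thesis
    unfolding eval_m1_def by (intro exI[of _ "max N M"]) (simp add: distrib_left)
qed

lemma eval_m1_mult:
  assumes "eval_m1 f u" "eval_m1 g v"
  shows "eval_m1 (f * g) (u * v)"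
proof -
  obtain N M where NM: "abs_eval_m1 ((1 - fps_X) ^ N * f) (2 ^ N * u)"
    "abs_eval_m1 ((1 - fps_X) ^ M * g) (2 ^ M * v)"
    using assms unfolding eval_m1_def by blast
  show ?thesis
    unfolding eval_m1_def using abs_eval_m1_mult[OF NM]
    by (intro exI[of _ "N + M"]) (simp add: power_add mult_ac)
qed

lemma eval_m1_power: "eval_m1 f u \<Longrightarrow> eval_m1 (f ^ n) (u ^ n)"
  using eval_m1_const[of 1] by (induction n) (auto intro: eval_m1_mult)

lemma eval_m1_sum:
  assumes "\<And>i. i \<in> A \<Longrightarrow> eval_m1 (f i) (u i)"
  shows "eval_m1 (sum f A) (sum u A)"
  using assms eval_m1_const[of 0]
  by (induction A rule: infinite_finite_induct) (auto intro: eval_m1_add)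

text \<open>Summation by parts expresses the alternating sums of \<open>f\<close> through those of \<open>(1 - X) f\<close>.\<close>

lemma bounded_variation_eval_m1:
  assumes "summable (\<lambda>n. \<bar>((1 - fps_X) * f) $ n\<bar>)" and "fps_nth f \<longlonglongrightarrow> 0"
  shows "\<exists>v. eval_m1 f v \<and> (\<lambda>n. (- 1) ^ n * f $ n) sums v"
proof -
  define d where "d = (1 - fps_X) * f"
  obtain w where w: "abs_eval_m1 d w"
    using abs_eval_m1_exists assms(1) d_def by blast
  \<comment> \<open>Since d_n = f_n - f_(n-1), both halves contribute the same alternating sum
    except for the last term, so the alternating sum of d is twice that of f minus (-1)^N
    f_N.\<close>
  have parts: "(\<Sum>n\<le>N. (- 1) ^ n * f $ n) = ((\<Sum>n\<le>N. (- 1) ^ n * d $ n) + (- 1) ^ N * f $ N) / 2" for N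
    by (induction N) (simp_all add: d_def algebra_simps)
  have "(\<lambda>N. (- 1) ^ N * f $ N) \<longlonglongrightarrow> 0"
    using assms(2) by (intro tendsto_norm_zero_cancel[of "\<lambda>N. (- 1) ^ N * f $ N"])
      (simp add: abs_mult tendsto_rabs_zero_iff)
  moreover have "(\<lambda>N. \<Sum>n\<le>N. (- 1) ^ n * d $ n) \<longlonglongrightarrow> w"
    using w by (simp add: abs_eval_m1_def sums_def_le)
  ultimately have "(\<lambda>N. \<Sum>n\<le>N. (- 1) ^ n * f $ n) \<longlonglongrightarrow> (w + 0) / 2"
    unfolding parts by (intro tendsto_intros) auto
  moreover have "eval_m1 f (w / 2)"
    unfolding eval_m1_def by (rule exI[of _ 1]) (use w in \<open>simp add: d_def\<close>)
  ultimately show ?thesis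
    by (auto simp: sums_def_le)
qed

subsection \<open>Multiple polylogarithms as formal power series\<close>

text \<open>The largest index of the nested sum is fixed at n, the others are summed below it. For a
  nonempty word the inner sum is empty at n = 0, so the constant term is 0.\<close>

fun mpl_coeff :: "nat list \<Rightarrow> nat \<Rightarrow> real" where
  "mpl_coeff [] n = (if n = 0 then 1 else 0)"
| "mpl_coeff (s # ss) n = (\<Sum>j<n. mpl_coeff ss j) / real n ^ s"

definition mpl :: "nat list \<Rightarrow> real fps" where
  "mpl ss = Abs_fps (mpl_coeff ss)"

lemma mpl_nth: "mpl ss $ n = mpl_coeff ss n"
  by (simp add: mpl_def)

lemma mpl_Nil: "mpl [] = 1"
  by (rule fps_ext) (simp add: mpl_nth)

lemma mpl_coeff_nonneg: "mpl_coeff ss n \<ge> 0"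
  by (induction ss arbitrary: n) (auto intro!: divide_nonneg_nonneg sum_nonneg)

text \<open>The derivative has the partial sums of \<open>mpl_coeff ss\<close> as coefficients;
  multiplying by 1 - X takes their differences.\<close>

lemma deriv_mpl_one: "(1 - fps_X) * fps_deriv (mpl (1 # ss)) = mpl ss"
proof (rule fps_ext)
  fix n
  show "((1 - fps_X) * fps_deriv (mpl (1 # ss))) $ n = mpl ss $ n"
    by (cases n) (simp_all add: mpl_nth left_diff_distrib del: of_nat_Suc)
qed

text \<open>The operator X d/dX multiplies the n-th coefficient by n, lowering the leading exponent
  by one.\<close>

lemma deriv_mpl_two: "fps_X * fps_deriv (mpl (2 # ss)) = mpl (1 # ss)"
proof (rule fps_ext)
  fix n
  show "(fps_X * fps_deriv (mpl (2 # ss))) $ n = mpl (1 # ss) $ n"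
    by (cases n) (simp_all add: mpl_nth power2_eq_square del: of_nat_Suc)
qed

text \<open>Power series over the reals form an integral domain, so c cancels; it will be 1 - X or X
  (1 - X), matching the two differential rules above.\<close>

lemma fps_eqI_deriv:
  fixes f g c :: "real fps"
  assumes "c * fps_deriv f = c * fps_deriv g" "c \<noteq> 0" "f $ 0 = g $ 0"
  shows "f = g"
  using assms fps_deriv_eq_iff[of f g] by simp

lemma one_minus_fps_X_neq_0: "(1 - fps_X :: real fps) \<noteq> 0"
proof
  assume "(1 - fps_X :: real fps) = 0"
  then have "(1 - fps_X :: real fps) $ 0 = 0" by simp
  then show False by simp
qed

lemma mpl_ones: "mpl (replicate k 1) = fps_const (1 / fact k) * mpl [1] ^ k"
proof (induction k)
  case 0
  show ?case by (simp add: mpl_Nil)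
next
  case (Suc k)
  show ?case
  proof (rule fps_eqI_deriv[OF _ one_minus_fps_X_neq_0])
    have "(1 - fps_X) * fps_deriv (fps_const (1 / fact (Suc k)) * mpl [1] ^ Suc k) =
        fps_const (1 / fact (Suc k)) * fps_const (real (Suc k)) *
          ((1 - fps_X) * fps_deriv (mpl [1])) * mpl [1] ^ k"
      by (simp add: fps_deriv_power mult_ac del: fact_Suc power_Suc of_nat_Suc fps_const_mult)
    also have "\<dots> = fps_const (1 / fact k) * mpl [1] ^ k"
      unfolding deriv_mpl_one by (simp add: mpl_Nil del: of_nat_Suc)
    finally show "(1 - fps_X) * fps_deriv (mpl (replicate (Suc k) 1)) =
        (1 - fps_X) * fps_deriv (fps_const (1 / fact (Suc k)) * mpl [1] ^ Suc k)"
      using Suc deriv_mpl_one[of "replicate k 1"] by simp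
  qed (simp add: mpl_nth)
qed

text \<open>Here k is one less than the k of the theorem, which explains \<open>Suc k\<close> in the
  binomial coefficient.\<close>

lemma mpl_identity:
  fixes m k :: nat
  defines "L \<equiv> mpl [1]"
  defines "F \<equiv> \<lambda>i. mpl (replicate i 1 @ 2 # replicate k 1)"
  shows "(\<Sum>i\<le>m. fps_const ((- 1) ^ i / fact i) * L ^ i * F (m - i)) =
    fps_const ((- 1) ^ m * real ((m + Suc k) choose Suc k)) * mpl (2 # replicate (m + k) 1)"
    (is "?G = ?R")
proof (rule fps_eqI_deriv)
  define a where "a = (\<lambda>i. fps_const ((- 1) ^ i / fact i) * L ^ i)"
  let ?D = "\<lambda>f :: real fps. (1 - fps_X) * fps_deriv f"
  have DL: "?D L = 1"
    using deriv_mpl_one[of "[]"] by (simp add: L_def mpl_Nil)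
  have Da0: "?D (a 0) = 0"
    by (simp add: a_def)
  have DaS: "?D (a (Suc i)) = - a i" for i
  proof -
    have "?D (a (Suc i)) = fps_const ((- 1) ^ Suc i / fact (Suc i)) * fps_const (real (Suc i)) * ?D L * L ^ i"
      by (simp add: a_def fps_deriv_power mult_ac del: fact_Suc power_Suc of_nat_Suc fps_const_mult)
    also have "\<dots> = - a i"
      by (simp add: DL a_def del: of_nat_Suc flip: fps_const_neg)
    finally show ?thesis .
  qed
  have DFS: "?D (F (Suc i)) = F i" for i
    using deriv_mpl_one[of "replicate i 1 @ 2 # replicate k 1"] by (simp add: F_def)
  have Dmult: "?D (f * g) = f * ?D g + ?D f * g" for f g
    by (simp add: algebra_simps)
  have Dsum: "?D (sum f A) = (\<Sum>i\<in>A. ?D (f i))" for f :: "nat \<Rightarrow> real fps" and A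
    by (simp add: fps_deriv_sum sum_distrib_left)
  have "?D ?G = (\<Sum>i\<le>m. ?D (a i * F (m - i)))"
    by (simp only: Dsum a_def)
  also have "\<dots> = (\<Sum>i\<le>m. a i * ?D (F (m - i))) + (\<Sum>i\<le>m. ?D (a i) * F (m - i))"
    by (simp only: Dmult sum.distrib)
  \<comment> \<open>The term i = 0 drops out because \<open>a 0\<close> is constant; after the shift
    the sum cancels the other one except for its last term i = m.\<close>
  also have "(\<Sum>i\<le>m. ?D (a i) * F (m - i)) = (\<Sum>i<m. - a i * F (m - Suc i))"
    by (simp only: sum.atMost_shift Da0 DaS) simp
  also have "(\<Sum>i\<le>m. a i * ?D (F (m - i))) = (\<Sum>i<m. a i * ?D (F (m - i))) + a m * ?D (F 0)"
    by (simp flip: lessThan_Suc_atMost)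
  also have "(\<Sum>i<m. a i * ?D (F (m - i))) = (\<Sum>i<m. a i * F (m - Suc i))"
    by (intro sum.cong refl) (use DFS in \<open>metis Suc_diff_Suc lessThan_iff\<close>)
  finally have DG: "?D ?G = a m * ?D (F 0)"
    by (simp add: sum_negf)
  have "fps_X * (1 - fps_X) * fps_deriv ?G = fps_X * ?D ?G"
    by (simp only: mult.assoc)
  also have "\<dots> = (1 - fps_X) * (a m * (fps_X * fps_deriv (F 0)))"
    unfolding DG by (simp only: mult_ac)
  also have "fps_X * fps_deriv (F 0) = fps_const (1 / fact (Suc k)) * L ^ Suc k"
    using deriv_mpl_two[of "replicate k 1"] mpl_ones[of "Suc k"] by (simp add: F_def L_def)
  also have "a m * (fps_const (1 / fact (Suc k)) * L ^ Suc k) =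
      fps_const ((- 1) ^ m / fact m * (1 / fact (Suc k))) * L ^ (m + Suc k)"
    by (simp add: a_def power_add mult_ac del: fact_Suc flip: fps_const_mult)
  \<comment> \<open>The binomial coefficient is the ratio of 1/(m! (k+1)!) to 1/(m+k+1)!, the latter
    being the normalisation in \<open>mpl_ones\<close>.\<close>
  also have "(- 1) ^ m / fact m * (1 / fact (Suc k)) =
      (- 1) ^ m * real ((m + Suc k) choose Suc k) * (1 / fact (m + Suc k))"
  proof -
    have "real ((m + Suc k) choose Suc k) = fact (m + Suc k) / (fact (Suc k) * fact m)"
      by (subst binomial_fact) (simp_all del: fact_Suc add_Suc_right)
    then show ?thesis
      by (simp del: fact_Suc add_Suc_right binomial_Suc_Suc)
  qed
  also have "fps_const \<dots> * L ^ (m + Suc k) =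
      fps_const ((- 1) ^ m * real ((m + Suc k) choose Suc k)) * mpl (replicate (m + Suc k) 1)"
    by (simp only: mpl_ones L_def mult.assoc flip: fps_const_mult)
  also have "mpl (replicate (m + Suc k) 1) = fps_X * fps_deriv (mpl (2 # replicate (m + k) 1))"
    using deriv_mpl_two[of "replicate (m + k) 1"] by simp
  finally show "fps_X * (1 - fps_X) * fps_deriv ?G = fps_X * (1 - fps_X) * fps_deriv ?R"
    unfolding fps_deriv_mult_const_left by (simp only: mult_ac)
  show "?G $ 0 = ?R $ 0"
  proof -
    have "F i $ 0 = 0" for i
      by (cases i) (simp_all add: F_def mpl_nth)
    then show ?thesis
      by (simp add: fps_sum_nth mpl_nth)
  qed
qed (simp add: one_minus_fps_X_neq_0)

subsection \<open>Growth of the coefficients\<close>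

text \<open>The sequence H_n - ln n is decreasing and equals 1 at n = 1.\<close>

lemma harm_le_ln: "n > 0 \<Longrightarrow> harm n \<le> 1 + ln (real n)"
  using euler_mascheroni_sequence_decreasing[of 1 n] by (simp add: harm_expand)

text \<open>Forget the ordering of the indices: each runs below n with weight at most 1/j, so each
  letter costs at most one harmonic factor.\<close>

lemma sum_mpl_coeff_le: "(\<Sum>j<n. mpl_coeff ss j) \<le> (1 + harm n) ^ length ss"
  if "\<forall>s\<in>set ss. s \<ge> 1" for ss
  using that
proof (induction ss arbitrary: n)
  case Nil
  show ?case by (cases n) (simp_all add: sum.lessThan_Suc_shift)
next
  case (Cons s ss)
  have "mpl_coeff (s # ss) j \<le> inverse (real j) * (1 + harm n) ^ length ss" if "j < n" "j \<ge> 1" for j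
  proof -
    have "(\<Sum>i<j. mpl_coeff ss i) \<le> (1 + harm n) ^ length ss"
      using Cons.prems that
      by (intro order.trans[OF Cons.IH] power_mono add_left_mono harm_mono)
        (auto intro: add_nonneg_nonneg harm_nonneg)
    moreover have "real j ^ 1 \<le> real j ^ s"
      using that Cons.prems by (intro power_increasing) auto
    ultimately have "(\<Sum>i<j. mpl_coeff ss i) / real j ^ s \<le> (1 + harm n) ^ length ss / real j"
      using that by (intro frac_le) (auto intro!: sum_nonneg mpl_coeff_nonneg zero_le_power add_nonneg_nonneg harm_nonneg)
    then show ?thesis by (simp add: field_simps)
  qed
  then have "(\<Sum>j\<in>{1..<n}. mpl_coeff (s # ss) j) \<le> (\<Sum>j\<in>{1..<n}. inverse (real j) * (1 + harm n) ^ length ss)"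
    by (intro sum_mono) auto
  also have "\<dots> = (\<Sum>j\<in>{1..<n}. inverse (real j)) * (1 + harm n) ^ length ss"
    by (simp add: sum_distrib_right)
  also have "\<dots> \<le> (1 + harm n) * (1 + harm n) ^ length ss"
  proof (rule mult_right_mono)
    have "(\<Sum>j\<in>{1..<n}. inverse (real j)) \<le> harm n"
      unfolding harm_def by (rule sum_mono2) auto
    then show "(\<Sum>j\<in>{1..<n}. inverse (real j)) \<le> 1 + harm n" by simp
  qed (auto intro!: add_nonneg_nonneg harm_nonneg zero_le_power)
  also have "(\<Sum>j\<in>{1..<n}. mpl_coeff (s # ss) j) = (\<Sum>j<n. mpl_coeff (s # ss) j)"
    by (rule sum.mono_neutral_left) (auto simp: not_le Suc_le_eq)
  finally show ?case by simp
qed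

lemma sum_mpl_coeff_le_ln:
  assumes "\<forall>s\<in>set ss. s \<ge> 1" "n > 0"
  shows "(\<Sum>j<n. mpl_coeff ss j) \<le> (2 + ln (real n)) ^ length ss"
proof -
  have "1 + harm n \<le> 2 + ln (real n)"
    using harm_le_ln[OF assms(2)] by simp
  then show ?thesis
    using assms by (intro order.trans[OF sum_mpl_coeff_le] power_mono)
      (auto intro: add_nonneg_nonneg harm_nonneg)
qed

lemma summable_ln_power_over_square: "summable (\<lambda>n. (2 + ln (real n)) ^ r / real n ^ 2)"
proof (rule summable_comparison_test_bigo)
  \<comment> \<open>Any power of the logarithm is absorbed by n^(1/2), leaving the convergent
    exponent -3/2.\<close>
  show "summable (\<lambda>n. norm (real n powr (- 3 / 2)))"
    using summable_real_powr_iff[of "- 3 / 2"] by simp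
  show "(\<lambda>n. (2 + ln (real n)) ^ r / real n ^ 2) \<in> O(\<lambda>n. real n powr (- 3 / 2))"
    by real_asymp
qed

lemma mpl_coeff_two_summable:
  assumes "\<forall>s\<in>set ss. s \<ge> 1"
  shows "summable (\<lambda>n. \<bar>mpl_coeff (2 # ss) n\<bar>)"
proof (rule summable_comparison_test'[OF summable_ln_power_over_square[of "length ss"]])
  fix n :: nat assume "n \<ge> 1"
  then show "norm \<bar>mpl_coeff (2 # ss) n\<bar> \<le> (2 + ln (real n)) ^ length ss / real n ^ 2"
    using sum_mpl_coeff_le_ln[OF assms, of n] sum_nonneg[of "{..<n}" "mpl_coeff ss"]
    by (simp add: divide_right_mono mpl_coeff_nonneg)
qed

lemma mpl_coeff_one_tendsto_0:
  assumes "\<forall>s\<in>set ss. s \<ge> 1"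
  shows "mpl_coeff (1 # ss) \<longlonglongrightarrow> 0"
proof (rule tendsto_sandwich[where f = "\<lambda>_. 0"])
  show "\<forall>\<^sub>F n in sequentially. mpl_coeff (1 # ss) n \<le> (2 + ln (real n)) ^ length ss / real n"
    using eventually_gt_at_top[of 0]
    by eventually_elim (use sum_mpl_coeff_le_ln[OF assms] in \<open>simp add: divide_right_mono\<close>)
  show "(\<lambda>n. (2 + ln (real n)) ^ length ss / real n) \<longlonglongrightarrow> 0"
    by real_asymp
  show "\<forall>\<^sub>F n in sequentially. 0 \<le> mpl_coeff (1 # ss) n"
    by (intro always_eventually allI mpl_coeff_nonneg)
qed simp

text \<open>The coefficients are S_n / n with S_n a partial sum of c = \<open>mpl_coeff ss\<close>.
  Consecutive ones differ by c_n/(n+1) - S_n/(n(n+1)), and both terms are a power of a logarithm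
  over n^2.\<close>

lemma mpl_one_bounded_variation:
  assumes "\<forall>s\<in>set ss. s \<ge> 1"
  shows "summable (\<lambda>n. \<bar>((1 - fps_X) * mpl (1 # ss)) $ n\<bar>)"
proof -
  let ?S = "\<lambda>n. \<Sum>j<n. mpl_coeff ss j"
  have diff: "((1 - fps_X) * mpl (1 # ss)) $ Suc n = mpl_coeff ss n / real (Suc n) - ?S n / (real n * real (Suc n))"
    if "n > 0" for n
  proof -
    have "?S n / real (Suc n) - ?S n / real n = - ?S n / (real n * real (Suc n))"
      using that by (simp add: divide_simps) (simp add: algebra_simps)
    then show ?thesis
      by (simp add: left_diff_distrib mpl_nth add_divide_distrib)
  qed
  have S_bound: "?S n / (real n * real (Suc n)) \<le> (2 + ln (real n)) ^ length ss / real n ^ 2" if "n > 0" for n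
    unfolding power2_eq_square
    using that sum_mpl_coeff_le_ln[OF assms that] 
    by (intro frac_le mult_left_mono) (auto intro!: add_nonneg_nonneg zero_le_power)
  \<comment> \<open>For a nonempty word c_n carries its own factor of at most 1/n. For the empty
    word c_n = 0 when n > 0, and the truncated exponent \<open>length ss - 1\<close> is 0.\<close>
  have c_bound: "mpl_coeff ss n / real (Suc n) \<le> (2 + ln (real n)) ^ (length ss - 1) / real n ^ 2" if "n > 0" for n
  proof (cases ss)
    case Nil
    then show ?thesis using that by simp
  next
    case (Cons s ts)
    have "real n ^ 2 \<le> real n ^ s * real (Suc n)"
      unfolding power2_eq_square
      using that assms Cons self_le_power[of "real n" s] by (intro mult_mono) auto
    moreover have "(\<Sum>j<n. mpl_coeff ts j) \<le> (2 + ln (real n)) ^ length ts"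
      using assms Cons that by (intro sum_mpl_coeff_le_ln) auto
    ultimately have "(\<Sum>j<n. mpl_coeff ts j) / (real n ^ s * real (Suc n)) \<le> (2 + ln (real n)) ^ length ts / real n ^ 2"
      using that by (intro frac_le) (auto intro!: add_nonneg_nonneg zero_le_power)
    then show ?thesis by (simp add: Cons)
  qed
  have "summable (\<lambda>n. \<bar>((1 - fps_X) * mpl (1 # ss)) $ Suc n\<bar>)"
  proof (rule summable_comparison_test')
    show "summable (\<lambda>n. (2 + ln (real n)) ^ (length ss - 1) / real n ^ 2 + (2 + ln (real n)) ^ length ss / real n ^ 2)"
      by (intro summable_add summable_ln_power_over_square)
    fix n :: nat assume "n \<ge> 1"
    then have n: "n > 0" by simp
    have "0 \<le> mpl_coeff ss n / real (Suc n)" "0 \<le> ?S n / (real n * real (Suc n))"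
      by (auto intro!: divide_nonneg_nonneg sum_nonneg mpl_coeff_nonneg)
    then show "norm \<bar>((1 - fps_X) * mpl (1 # ss)) $ Suc n\<bar> \<le>
        (2 + ln (real n)) ^ (length ss - 1) / real n ^ 2 + (2 + ln (real n)) ^ length ss / real n ^ 2"
      unfolding diff[OF n] real_norm_def using S_bound[OF n] c_bound[OF n] by linarith
  qed
  then show ?thesis by (subst (asm) summable_Suc_iff)
qed

subsection \<open>Multiple zeta values as coefficient sums\<close>

lemma mzv_indices_0: "mzv_indices 0 n = {[]}"
  by (auto simp: mzv_indices_def)

lemma Cons_in_mzv_indices_iff:
  "j # ks \<in> mzv_indices (Suc r) n \<longleftrightarrow> j \<in> {1..n} \<and> ks \<in> mzv_indices r (j - 1)"
proof -
  have "(\<forall>x\<in>set ks. x < j) \<and> set ks \<subseteq> {1..n} \<longleftrightarrow> set ks \<subseteq> {1..j - 1}" if "j \<in> {1..n}"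
  proof -
    have "x < j \<and> x \<in> {1..n} \<longleftrightarrow> x \<in> {1..j - 1}" for x
      using that by auto
    then show ?thesis by blast
  qed
  then show ?thesis
    unfolding mzv_indices_def by auto
qed

lemma mzv_indices_Suc: "mzv_indices (Suc r) n = (\<Union>j\<in>{1..n}. (#) j ` mzv_indices r (j - 1))"
proof (rule set_eqI)
  fix ks
  show "ks \<in> mzv_indices (Suc r) n \<longleftrightarrow> ks \<in> (\<Union>j\<in>{1..n}. (#) j ` mzv_indices r (j - 1))"
  proof (cases ks)
    case Nil
    then show ?thesis by (auto simp: mzv_indices_def)
  next
    case (Cons j js)
    then show ?thesis unfolding Cons Cons_in_mzv_indices_iff by blast
  qed
qed

lemma finite_mzv_indices: "finite (mzv_indices r n)"
  by (induction r arbitrary: n) (simp_all add: mzv_indices_0 mzv_indices_Suc)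

lemma mzv_partial_sum_Nil: "mzv_partial_sum [] n = 1"
  by (simp add: mzv_partial_sum_def mzv_indices_0)

text \<open>Splitting off the largest index j leaves a chain bounded by j - 1, which is the
  recursion pattern of \<open>mpl_coeff\<close>.\<close>

lemma mzv_partial_sum_Cons:
  "mzv_partial_sum (s # ss) n = (\<Sum>j=1..n. mzv_factor s j * mzv_partial_sum ss (j - 1))"
proof -
  let ?p = "\<lambda>ss ks. \<Prod>i<length ss. mzv_factor (ss ! i) (ks ! i)"
  have "mzv_partial_sum (s # ss) n =
      (\<Sum>j=1..n. \<Sum>ks\<in>(#) j ` mzv_indices (length ss) (j - 1). ?p (s # ss) ks)"
    unfolding mzv_partial_sum_def list.size add_Suc_right add_0_right mzv_indices_Suc
    by (rule sum.UNION_disjoint) (auto simp: finite_mzv_indices)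
  also have "\<dots> = (\<Sum>j=1..n. \<Sum>ks\<in>mzv_indices (length ss) (j - 1). ?p (s # ss) (j # ks))"
    by (simp add: sum.reindex)
  also have "\<dots> = (\<Sum>j=1..n. mzv_factor s j * mzv_partial_sum ss (j - 1))"
    by (simp add: mzv_partial_sum_def prod.lessThan_Suc_shift sum_distrib_left
        del: prod.lessThan_Suc)
  finally show ?thesis .
qed

text \<open>The bound n is inclusive for zeta sums but strict in \<open>mpl_coeff\<close>, hence
  \<open>Suc n\<close>. The index 0 contributes only for the empty word, where it supplies the value
  1.\<close>

lemma mzv_partial_sum_Plain:
  "mzv_partial_sum (map Plain ss) n = (\<Sum>j<Suc n. mpl_coeff ss j)"
proof (induction ss arbitrary: n)
  case Nil
  show ?case by (simp add: mzv_partial_sum_Nil sum.lessThan_Suc_shift del: sum.lessThan_Suc)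
next
  case (Cons s ss)
  have "mzv_partial_sum (map Plain (s # ss)) n = (\<Sum>j=1..n. mpl_coeff (s # ss) j)"
    by (auto simp: mzv_partial_sum_Cons Cons.IH intro!: sum.cong simp del: sum.lessThan_Suc)
  also have "\<dots> = (\<Sum>j<Suc n. mpl_coeff (s # ss) j)"
    by (rule sum.mono_neutral_left) (auto simp: not_le Suc_le_eq)
  finally show ?case .
qed

text \<open>The only bar sits on the largest index, which is the exponent of X; its sign is
  therefore exactly evaluation at X = -1.\<close>

lemma mzv_partial_sum_Bar:
  "mzv_partial_sum (Bar s # map Plain ss) n = (\<Sum>j\<le>n. (- 1) ^ j * mpl_coeff (s # ss) j)"
proof -
  have "mzv_partial_sum (Bar s # map Plain ss) n = (\<Sum>j=1..n. (- 1) ^ j * mpl_coeff (s # ss) j)"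
    by (auto simp: mzv_partial_sum_Cons mzv_partial_sum_Plain intro!: sum.cong
        simp del: sum.lessThan_Suc)
  also have "\<dots> = (\<Sum>j\<le>n. (- 1) ^ j * mpl_coeff (s # ss) j)"
    by (rule sum.mono_neutral_left) (auto simp: not_le Suc_le_eq)
  finally show ?thesis .
qed

text \<open>Convergence is a premise, so \<open>lim\<close> here denotes a genuine limit and not an
  arbitrary value.\<close>

lemma mzv_eqI:
  assumes "(\<lambda>n. (- 1) ^ n * mpl (s # ss) $ n) sums v"
  shows "mzv (Bar s # map Plain ss) = v"
  using assms unfolding mzv_def sums_def_le mpl_nth
  by (intro limI) (simp add: mzv_partial_sum_Bar[abs_def] del: mpl_coeff.simps)

text \<open>Bounded variation and decay to 0 give one number that is both the regularised value and
  the limit of the conditionally convergent series.\<close>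

lemma eval_m1_mpl_one:
  assumes "\<forall>s\<in>set ss. s \<ge> 1"
  shows "eval_m1 (mpl (1 # ss)) (mzv (Bar 1 # map Plain ss))"
proof -
  have "fps_nth (mpl (1 # ss)) \<longlonglongrightarrow> 0"
    using mpl_coeff_one_tendsto_0[OF assms] by (simp add: mpl_nth[abs_def] del: mpl_coeff.simps)
  then show ?thesis
    using bounded_variation_eval_m1[OF mpl_one_bounded_variation[OF assms]] mzv_eqI by blast
qed

lemma eval_m1_mpl_two:
  assumes "\<forall>s\<in>set ss. s \<ge> 1"
  shows "eval_m1 (mpl (2 # ss)) (mzv (Bar 2 # map Plain ss))"
proof -
  obtain v where v: "abs_eval_m1 (mpl (2 # ss)) v"
    using abs_eval_m1_exists[of "mpl (2 # ss)"] mpl_coeff_two_summable[OF assms]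
    by (auto simp only: mpl_nth)
  then have "mzv (Bar 2 # map Plain ss) = v"
    by (intro mzv_eqI) (simp add: abs_eval_m1_def)
  with v show ?thesis
    by (simp add: abs_eval_m1_imp_eval_m1)
qed

lemma mzv_Bar_1: "mzv [Bar 1] = - ln 2"
proof -
  have "(\<lambda>n. (- 1) ^ Suc n * mpl [1] $ Suc n) = (\<lambda>n. - ((- 1) ^ n / real (Suc n)))"
    by (auto simp: mpl_nth sum.lessThan_Suc_shift simp del: sum.lessThan_Suc)
  then have "(\<lambda>n. (- 1) ^ Suc n * mpl [1] $ Suc n) sums (- ln 2)"
    using sums_minus[OF alternating_harmonic_series_sums] by simp
  then have "(\<lambda>n. (- 1) ^ n * mpl [1] $ n) sums (- ln 2)"
    by (subst (asm) sums_Suc_iff) (simp add: mpl_nth)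
  from mzv_eqI[OF this] show ?thesis by simp
qed

theorem theorem2p3:
  fixes m k :: nat
  assumes "m \<ge> 1" and "k \<ge> 1"
  shows "mzv ([Bar 1] @ replicate (m - 1) (Plain 1) @ [Plain 2] @ replicate (k - 1) (Plain 1)) =
      (- 1) ^ m * real ((m + k) choose k) * mzv ([Bar 2] @ replicate (m + k - 1) (Plain 1))
      - (ln 2) ^ m / fact m * mzv ([Bar 2] @ replicate (k - 1) (Plain 1))
      - (\<Sum>i = 1..m - 1. (ln 2) ^ i / fact i *
          mzv ([Bar 1] @ replicate (m - i - 1) (Plain 1) @ [Plain 2] @ replicate (k - 1) (Plain 1)))"
proof -
  obtain k' where k: "k = Suc k'"
    using assms(2) by (cases k) auto
  define F where "F = (\<lambda>i. mpl (replicate i 1 @ 2 # replicate k' 1))"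
  \<comment> \<open>The bar falls on the first letter of the word of \<open>F i\<close>: this is 2
    when i = 0 and 1 otherwise.\<close>
  define Z where "Z = (\<lambda>i. if i = 0 then mzv ([Bar 2] @ replicate k' (Plain 1))
    else mzv ([Bar 1] @ replicate (i - 1) (Plain 1) @ [Plain 2] @ replicate k' (Plain 1)))"
  define W where "W = mzv ([Bar 2] @ replicate (m + k') (Plain 1))"
  have F: "eval_m1 (F i) (Z i)" for i
  proof (cases i)
    case 0
    then show ?thesis
      using eval_m1_mpl_two[of "replicate k' 1"] by (simp add: F_def Z_def)
  next
    case (Suc j)
    then show ?thesis
      using eval_m1_mpl_one[of "replicate j 1 @ 2 # replicate k' 1"]
      by (simp add: F_def Z_def ball_Un)
  qed
  have L: "eval_m1 (mpl [1]) (- ln 2)"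
    using eval_m1_mpl_one[of "[]"] mzv_Bar_1 by simp
  have "eval_m1 (\<Sum>i\<le>m. fps_const ((- 1) ^ i / fact i) * mpl [1] ^ i * F (m - i))
      (\<Sum>i\<le>m. (- 1) ^ i / fact i * (- ln 2) ^ i * Z (m - i))"
    by (intro eval_m1_sum eval_m1_mult eval_m1_const eval_m1_power L F)
  moreover have "eval_m1 (fps_const ((- 1) ^ m * real ((m + k) choose k)) * mpl (2 # replicate (m + k') 1))
      ((- 1) ^ m * real ((m + k) choose k) * W)"
    using eval_m1_mpl_two[of "replicate (m + k') 1"]
    by (intro eval_m1_mult eval_m1_const) (simp add: W_def)
  ultimately have "(\<Sum>i\<le>m. (- 1) ^ i / fact i * (- ln 2) ^ i * Z (m - i)) =
      (- 1) ^ m * real ((m + k) choose k) * W"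
    using mpl_identity[of m k'] eval_m1_unique by (simp add: F_def k)
  \<comment> \<open>The sign of \<open>a i\<close> in the series identity cancels the sign of L = -
    ln 2 at X = -1.\<close>
  moreover have "(- 1 :: real) ^ i / fact i * (- ln 2) ^ i = ln 2 ^ i / fact i" for i
    by (simp flip: power_mult_distrib)
  ultimately have eq: "(\<Sum>i\<le>m. ln 2 ^ i / fact i * Z (m - i)) =
      (- 1) ^ m * real ((m + k) choose k) * W"
    by simp
  \<comment> \<open>The term i = 0 is the left-hand side of the theorem, i = m gives the value with
    a barred 2, and the rest is the final sum, empty for m = 1.\<close>
  have "{..m} = insert 0 (insert m {1..m - 1})"
    using assms(1) by auto
  then have "(\<Sum>i\<le>m. ln 2 ^ i / fact i * Z (m - i)) =
      Z m + (ln 2 ^ m / fact m * Z 0 + (\<Sum>i=1..m - 1. ln 2 ^ i / fact i * Z (m - i)))"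
    using assms(1) by (auto simp: sum.insert)
  moreover have "(\<Sum>i=1..m - 1. ln 2 ^ i / fact i * Z (m - i)) = (\<Sum>i = 1..m - 1. (ln 2) ^ i / fact i *
      mzv ([Bar 1] @ replicate (m - i - 1) (Plain 1) @ [Plain 2] @ replicate (k - 1) (Plain 1)))"
    using assms(1) by (intro sum.cong) (auto simp: Z_def k)
  ultimately show ?thesis
    using eq assms(1) by (simp add: Z_def W_def k)
qed

end
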